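(* Let $(\Omega,\mathcal{F},\mathbb{P})$ be a probability space, let $W\colon[0,\infty)\times\Omega\to\mathbb{R}$ be a one-dimensional standard Brownian motion, let $T\in(0,\infty)$ and let $X^x=(X^x_1,X^x_2,X^x_3)\colon[0,\infty)\times\Omega\to\mathbb{R}^3$, $x\in\mathbb{R}^3$, be the (up to indistinguishability unique) solution processes with continuous sample paths of the SDE $$dX^x_1(t)=\cos\!\big(X^x_3(t)\cdot\exp(X^x_2(t)^3)\big)\,dt,\qquad dX^x_2(t)=\sqrt{2}\,dW(t),\qquad dX^x_3(t)=0\,dt$$ for $t\in[0,\infty)$, satisfying $X^x(0)=x$ for all $x\in\mathbb{R}^3$. Then there exists an infinitely often differentiable function $\varphi\colon\mathbb{R}^3\to\mathbb{R}$ with compact support such that for every $t\in(0,T]$ the functions $$\mathbb{R}^3\ni x\mapsto\mathbb{E}[X^x(t)]\in\mathbb{R}^3\qquad\text{and}\qquad\mathbb{R}^3\ni x\mapsto\mathbb{E}[\varphi(X^x(t))]\in\mathbb{R}$$ are continuous but not locally Hölder continuous.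
   Context: A function is locally Hölder continuous if every point has a neighborhood on which it is Hölder continuous with some exponent in $(0,1]$. *)

theory Defs
  imports "HOL-Probability.Probability"
begin

text \<open>
  Processes with time set \<open>[0,\<infinity>)\<close> are functions of a real time argument; every condition
  is guarded by \<open>t \<ge> 0\<close>, and values at negative times are irrelevant.
\<close>

text \<open>
  The conditions \<open>W\<^sub>0 = 0\<close> and path continuity are only required almost surely, which also covers
  the convention that they hold for every sample point.
\<close>

definition standard_brownian_motion :: "'w measure \<Rightarrow> (real \<Rightarrow> 'w \<Rightarrow> real) \<Rightarrow> bool" where
  "standard_brownian_motion M W \<longleftrightarrow>
     prob_space M \<and>
     (\<forall>t\<ge>0. W t \<in> borel_measurable M) \<and>
     (AE \<omega> in M. W 0 \<omega> = 0) \<and>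
     (\<forall>s t. 0 \<le> s \<and> s < t \<longrightarrow>
        distributed M lborel (\<lambda>\<omega>. W t \<omega> - W s \<omega>) (normal_density 0 (sqrt (t - s)))) \<and>
     (\<forall>(n::nat) \<tau>. 0 \<le> \<tau> 0 \<and> (\<forall>i<n. \<tau> i < \<tau> (Suc i)) \<longrightarrow>
        prob_space.indep_vars M (\<lambda>_. borel) (\<lambda>i \<omega>. W (\<tau> (Suc i)) \<omega> - W (\<tau> i) \<omega>) {..<n}) \<and>
     (AE \<omega> in M. continuous_on {0..} (\<lambda>t. W t \<omega>))"

text \<open>
  Solution processes with continuous sample paths of the SDE
  \<open>dX(t) = \<mu>(X(t)) dt + \<sigma> dW(t)\<close>, \<open>X(0) = x\<close>, for a constant diffusion vector \<open>\<sigma>\<close> and a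
  one-dimensional driving process \<open>W\<close>. The stochastic integral over \<open>[0,t]\<close> of the constant (hence
  simple) integrand \<open>\<sigma>\<close> is by definition \<open>(W\<^sub>t - W\<^sub>0) \<sigma>\<close>.
\<close>

definition additive_noise_SDE_solution ::
  "'w measure \<Rightarrow> (real \<Rightarrow> 'w \<Rightarrow> real) \<Rightarrow> ('a::euclidean_space \<Rightarrow> 'a) \<Rightarrow> 'a \<Rightarrow> 'a
     \<Rightarrow> (real \<Rightarrow> 'w \<Rightarrow> 'a) \<Rightarrow> bool" where
  "additive_noise_SDE_solution M W \<mu> \<sigma> x X \<longleftrightarrow>
     (\<forall>t\<ge>0. X t \<in> borel_measurable M) \<and>
     (\<forall>\<omega>\<in>space M. continuous_on {0..} (\<lambda>t. X t \<omega>)) \<and>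
     (AE \<omega> in M. X 0 \<omega> = x) \<and>
     (AE \<omega> in M. \<forall>t\<ge>0.
        set_integrable lborel {0..t} (\<lambda>s. \<mu> (X s \<omega>)) \<and>
        X t \<omega> = X 0 \<omega> + (LINT s:{0..t}|lborel. \<mu> (X s \<omega>)) + (W t \<omega> - W 0 \<omega>) *\<^sub>R \<sigma>)"

definition drift :: "real ^ 3 \<Rightarrow> real ^ 3" where
  "drift x = vector [cos (x $ 3 * exp ((x $ 2) ^ 3)), 0, 0]"

definition diffusion :: "real ^ 3" where
  "diffusion = vector [0, sqrt 2, 0]"

text \<open>
  On a finite-dimensional domain, continuity of the derivative is continuity of all
  directional derivatives \<open>x \<mapsto> f'(x) v\<close>.
\<close>

primrec times_cont_differentiable ::
  "nat \<Rightarrow> ('a::euclidean_space \<Rightarrow> 'b::real_normed_vector) \<Rightarrow> bool" where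
  "times_cont_differentiable 0 f \<longleftrightarrow> continuous_on UNIV f"
| "times_cont_differentiable (Suc n) f \<longleftrightarrow>
     (\<forall>x. f differentiable (at x)) \<and>
     (\<forall>v. times_cont_differentiable n (\<lambda>x. frechet_derivative f (at x) v))"

definition infinitely_differentiable ::
  "('a::euclidean_space \<Rightarrow> 'b::real_normed_vector) \<Rightarrow> bool" where
  "infinitely_differentiable f \<longleftrightarrow> (\<forall>n. times_cont_differentiable n f)"

definition compactly_supported :: "('a::topological_space \<Rightarrow> 'b::zero) \<Rightarrow> bool" where
  "compactly_supported f \<longleftrightarrow> compact (closure {x. f x \<noteq> 0})"

text \<open>For \<open>x = y\<close> the inequality reads \<open>0 \<le> 0\<close>, since \<open>0 powr \<alpha> = 0\<close>.\<close>

definition hoelder_on :: "real \<Rightarrow> 'a::metric_space set \<Rightarrow> ('a \<Rightarrow> 'b::metric_space) \<Rightarrow> bool" where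
  "hoelder_on \<alpha> U f \<longleftrightarrow> (\<exists>C\<ge>0. \<forall>x\<in>U. \<forall>y\<in>U. dist (f x) (f y) \<le> C * dist x y powr \<alpha>)"

definition locally_hoelder :: "('a::metric_space \<Rightarrow> 'b::metric_space) \<Rightarrow> bool" where
  "locally_hoelder f \<longleftrightarrow>
     (\<forall>x. \<exists>U \<alpha>. open U \<and> x \<in> U \<and> 0 < \<alpha> \<and> \<alpha> \<le> 1 \<and> hoelder_on \<alpha> U f)"

end

theory Submission
  imports Defs "HOL-Real_Asymp.Real_Asymp"
begin

text \<open>
  The second and third components of the solution are explicit, so up to null sets
  \<open>X\<^sup>x\<^sub>1(t) = x\<^sub>1 + \<integral>\<^sub>0\<^sup>t cos (x\<^sub>3 exp ((x\<^sub>2 + B\<^sub>s)\<^sup>3)) ds\<close> with \<open>B = \<surd>2 W\<close>, and both continuity claims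
  are dominated convergence. For \<open>x\<^sub>2 = 0\<close>, moving \<open>x\<^sub>3\<close> from \<open>0\<close> to \<open>h = exp (-a\<^sup>3)\<close> makes the cosine drop by
  a fixed amount whenever \<open>B\<^sub>s\<close> lies in \<open>[a, a + 1/(8a\<^sup>2)]\<close>. This has probability of order
  \<open>exp (-O(a\<^sup>2))\<close>, which is far larger than every power \<open>h\<^sup>\<alpha> = exp (-\<alpha>a\<^sup>3)\<close>, even
  when \<open>B\<close> is required to return to \<open>[-1, 1]\<close> at time \<open>t\<close>. The return makes the loss visible to a
  compactly supported test function \<open>\<phi>(x) = f(R - |x|\<^sup>2)\<close>: with \<open>f\<close> increasing and \<open>x\<^sub>1\<close> started at \<open>-2T\<close>,
  a smaller \<open>X\<^sub>1(t)\<close> and a nonzero \<open>X\<^sub>3(t)\<close> both increase \<open>|X(t)|\<close>, so no cancellation can occur.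
\<close>

subsection \<open>Smooth functions of compact support\<close>

text \<open>Derivatives are unique, so the chosen \<open>frechet_derivative\<close> may be replaced
  by any explicit formula \<open>D\<close>.\<close>

lemma times_cont_differentiable_SucI:
  assumes "\<And>x. (f has_derivative D x) (at x)"
    and "\<And>v. times_cont_differentiable n (\<lambda>x. D x v)"
  shows "times_cont_differentiable (Suc n) f"
proof -
  have "frechet_derivative f (at x) = D x" for x
    using frechet_derivative_at[OF assms(1)] by metis
  then show ?thesis
    using assms by (auto simp: differentiable_def)
qed

lemma times_cont_differentiable_SucD:
  "times_cont_differentiable (Suc n) f \<Longrightarrow> times_cont_differentiable n f"
proof (induction n arbitrary: f)
  case 0
  then show ?case
    by (auto intro!: differentiable_imp_continuous_on simp: differentiable_on_eq_differentiable_at)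
next
  case (Suc n)
  then show ?case by (metis times_cont_differentiable.simps(2))
qed

lemma times_cont_differentiable_const: "times_cont_differentiable n (\<lambda>x. c)"
proof (induction n arbitrary: c)
  case (Suc n)
  show ?case
    by (rule times_cont_differentiable_SucI[where D = "\<lambda>_ _. 0"]) (auto intro: Suc)
qed auto

lemma times_cont_differentiable_bounded_linear:
  assumes "bounded_linear f"
  shows "times_cont_differentiable n f"
proof (cases n)
  case 0
  then show ?thesis using assms by (simp add: linear_continuous_on)
next
  case (Suc m)
  show ?thesis unfolding Suc
    by (rule times_cont_differentiable_SucI[where D = "\<lambda>_. f"])
       (auto intro: times_cont_differentiable_const bounded_linear_imp_has_derivative assms)
qed

lemma times_cont_differentiable_add:
  "times_cont_differentiable n f \<Longrightarrow> times_cont_differentiable n g \<Longrightarrow>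
    times_cont_differentiable n (\<lambda>x. f x + g x)"
proof (induction n arbitrary: f g)
  case 0
  then show ?case by (auto intro: continuous_intros)
next
  case (Suc n)
  show ?case
    by (rule times_cont_differentiable_SucI
          [where D = "\<lambda>x v. frechet_derivative f (at x) v + frechet_derivative g (at x) v"])
       (use Suc in \<open>auto intro!: has_derivative_add simp: frechet_derivative_works[symmetric]\<close>)
qed

lemma times_cont_differentiable_mult:
  fixes f g :: "'a::euclidean_space \<Rightarrow> 'b::real_normed_algebra"
  shows "times_cont_differentiable n f \<Longrightarrow> times_cont_differentiable n g \<Longrightarrow>
    times_cont_differentiable n (\<lambda>x. f x * g x)"
proof (induction n arbitrary: f g)
  case 0
  then show ?case by (auto intro: continuous_intros)
next
  case (Suc n)
  \<comment> \<open>The product rule keeps one factor undifferentiated, so order \<open>n\<close> is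
    wanted for \<open>f\<close> and \<open>g\<close> as well as for their derivatives.\<close>
  have "times_cont_differentiable n f" "times_cont_differentiable n g"
    using Suc.prems by (blast intro: times_cont_differentiable_SucD)+
  then show ?case
    by (intro times_cont_differentiable_SucI
          [where D = "\<lambda>x v. f x * frechet_derivative g (at x) v + frechet_derivative f (at x) v * g x"])
       (use Suc in \<open>auto intro!: has_derivative_mult times_cont_differentiable_add
          simp: frechet_derivative_works[symmetric]\<close>)
qed

text \<open>The polynomial factor makes this family closed under differentiation.\<close>

definition flat_exp :: "real poly \<Rightarrow> real \<Rightarrow> real" where
  "flat_exp p r = (if r > 0 then poly p (1 / r) * exp (- (1 / r)) else 0)"

text \<open>With \<open>k\<close> arbitrary the induction over coefficients closes: the tail of
  \<open>pCons a p\<close> is \<open>p\<close> with one more power of \<open>u\<close>.\<close>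

lemma tendsto_poly_mult_exp_0:
  "((\<lambda>u::real. u ^ k * poly p u * exp (- u)) \<longlongrightarrow> 0) at_top"
proof (induction p arbitrary: k)
  case (pCons a p)
  have "((\<lambda>u::real. a * (u ^ k / exp u) + u ^ Suc k * poly p u * exp (- u)) \<longlongrightarrow> a * 0 + 0) at_top"
    by (intro tendsto_intros pCons.IH tendsto_power_div_exp_0)
  then show ?case
    by (simp add: exp_minus field_simps)
qed simp

lemma flat_exp_tendsto_0: "(flat_exp p \<longlongrightarrow> 0) (at 0)"
proof -
  have "(flat_exp p \<longlongrightarrow> 0) (at_right 0)"
  proof (subst filterlim_at_right_to_top)
    have "\<forall>\<^sub>F u in at_top. u ^ 0 * poly p u * exp (- u) = flat_exp p (inverse u)"
      using eventually_gt_at_top[of "0::real"]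
      by eventually_elim (simp add: flat_exp_def inverse_eq_divide)
    from Lim_transform_eventually[OF tendsto_poly_mult_exp_0 this]
    show "((\<lambda>u. flat_exp p (inverse u)) \<longlongrightarrow> 0) at_top" .
  qed
  moreover have "(flat_exp p \<longlongrightarrow> 0) (at_left 0)"
    by (rule tendsto_eventually, rule eventually_at_leftI[of "-1"]) (auto simp: flat_exp_def)
  ultimately show ?thesis
    by (simp add: filterlim_split_at_real)
qed

text \<open>For \<open>r > 0\<close> and \<open>u = 1/r\<close>, differentiating
  \<open>p(u) exp (-u)\<close> in \<open>r\<close> gives \<open>u^2 (p(u) - p'(u)) exp (-u)\<close>,
  which explains the new polynomial.\<close>

lemma flat_exp_has_real_derivative:
  "(flat_exp p has_real_derivative flat_exp (monom 1 2 * (p - pderiv p)) r) (at r)"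
proof (cases r "0::real" rule: linorder_cases)
  case less
  have "((\<lambda>_. 0) has_real_derivative 0) (at r)" by simp
  then have "(flat_exp p has_real_derivative 0) (at r)"
    by (rule has_field_derivative_transform_within_open[where S = "{..<0}"])
       (use less in \<open>auto simp: flat_exp_def\<close>)
  then show ?thesis using less by (simp add: flat_exp_def)
next
  case equal
  have "((\<lambda>y. (flat_exp p y - flat_exp p 0) / (y - 0)) \<longlongrightarrow> 0) (at 0)"
  proof (rule Lim_transform_eventually)
    \<comment> \<open>Dividing by \<open>y\<close> multiplies the polynomial by its variable
      \<open>1/y\<close>, so the difference quotient at \<open>0\<close> belongs to the same
      family.\<close>
    show "(flat_exp (pCons 0 p) \<longlongrightarrow> 0) (at 0)" by (rule flat_exp_tendsto_0)
    show "\<forall>\<^sub>F y in at 0. flat_exp (pCons 0 p) y = (flat_exp p y - flat_exp p 0) / (y - 0)"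
      by (rule always_eventually) (simp add: flat_exp_def)
  qed
  then show ?thesis using equal by (simp add: has_field_derivative_iff flat_exp_def)
next
  case greater
  have "((\<lambda>r. poly p (1 / r) * exp (- (1 / r))) has_real_derivative
      flat_exp (monom 1 2 * (p - pderiv p)) r) (at r)"
    using greater
    by (auto intro!: derivative_eq_intros DERIV_chain2[OF poly_DERIV]
        simp: flat_exp_def poly_monom field_simps power2_eq_square)
  then show ?thesis
    by (rule has_field_derivative_transform_within_open[where S = "{0<..}"])
       (use greater in \<open>auto simp: flat_exp_def\<close>)
qed

lemma continuous_on_flat_exp: "continuous_on S (flat_exp p)"
  using DERIV_continuous_on[OF DERIV_subset[OF flat_exp_has_real_derivative]] by blast

text \<open>A directional derivative is another member of the family times a linear function of
  \<open>x\<close>; hence the induction on \<open>n\<close> with \<open>p\<close> arbitrary.\<close>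

lemma infinitely_differentiable_flat_exp_norm:
  "infinitely_differentiable (\<lambda>x::'a::euclidean_space. flat_exp p (R - x \<bullet> x))"
proof -
  have "times_cont_differentiable n (\<lambda>x::'a. flat_exp p (R - x \<bullet> x))" for n
  proof (induction n arbitrary: p)
    case 0
    show ?case
      by (auto intro!: continuous_intros continuous_on_compose2[OF continuous_on_flat_exp])
  next
    case (Suc n)
    let ?p' = "monom 1 2 * (p - pderiv p)"
    show ?case
    proof (rule times_cont_differentiable_SucI)
      show "((\<lambda>x::'a. flat_exp p (R - x \<bullet> x)) has_derivative
          (\<lambda>v. flat_exp ?p' (R - x \<bullet> x) * (-2 * (x \<bullet> v)))) (at x)" for x
        by (rule has_derivative_eq_rhs, rule DERIV_compose_FDERIV[OF flat_exp_has_real_derivative])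
           (auto intro!: derivative_eq_intros simp: inner_commute)
      show "times_cont_differentiable n (\<lambda>x::'a. flat_exp ?p' (R - x \<bullet> x) * (-2 * (x \<bullet> v)))" for v
        by (intro times_cont_differentiable_mult Suc times_cont_differentiable_bounded_linear
              times_cont_differentiable_const bounded_linear_inner_left)
    qed
  qed
  then show ?thesis by (simp add: infinitely_differentiable_def)
qed

lemma compactly_supported_flat_exp_norm:
  assumes "0 \<le> R"
  shows "compactly_supported (\<lambda>x::'a::euclidean_space. flat_exp p (R - x \<bullet> x))"
  unfolding compactly_supported_def
proof (rule compact_closure[THEN iffD2], rule bounded_subset[OF bounded_cball])
  show "{x::'a. flat_exp p (R - x \<bullet> x) \<noteq> 0} \<subseteq> cball 0 (sqrt R)"
    by (auto simp: flat_exp_def norm_eq_sqrt_inner split: if_splits)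
qed

lemma flat_exp_1_mono:
  assumes "r \<le> s" shows "flat_exp 1 r \<le> flat_exp 1 s"
  using assms by (auto simp: flat_exp_def frac_le)

lemma flat_exp_1_bounds: "0 \<le> flat_exp 1 r" "flat_exp 1 r \<le> 1"
  by (auto simp: flat_exp_def)

text \<open>Mean value theorem: on \<open>[1, Q]\<close> the derivative
  \<open>exp (-1/z) / z^2\<close> is at least \<open>exp (-1) / Q^2\<close>. This makes the drop of
  the test function quantitative.\<close>

lemma flat_exp_1_increment:
  assumes "1 \<le> r" "r \<le> s" "s \<le> Q"
  shows "exp (-1) / Q\<^sup>2 * (s - r) \<le> flat_exp 1 s - flat_exp 1 r"
proof (cases "r = s")
  case False
  then obtain z where z: "r < z" "z < s"
    and eq: "flat_exp 1 s - flat_exp 1 r = (s - r) * flat_exp (monom 1 2 * (1 - pderiv 1)) z"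
    using MVT2[of r s "flat_exp 1" "flat_exp (monom 1 2 * (1 - pderiv 1))"] flat_exp_has_real_derivative[of 1] assms
    by force
  have "exp (-1) / Q\<^sup>2 \<le> exp (- (1 / z)) / z\<^sup>2"
    using z assms by (intro frac_le) auto
  also have "\<dots> = flat_exp (monom 1 2 * (1 - pderiv 1)) z"
    using z assms by (simp add: flat_exp_def poly_monom power_one_over)
  finally show ?thesis
    unfolding eq mult.commute[of "s - r"] using assms by (intro mult_right_mono) auto
qed simp

subsection \<open>Processes with continuous paths\<close>

text \<open>The clipped time \<open>max 0 s\<close> avoids the uncontrolled values at negative times.\<close>

lemma measurable_pair_continuous_process:
  fixes B :: "real \<Rightarrow> 'w \<Rightarrow> real"
  assumes meas: "\<And>s. 0 \<le> s \<Longrightarrow> B s \<in> borel_measurable M"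
    and cont: "\<And>\<omega>. \<omega> \<in> space M \<Longrightarrow> continuous_on {0..} (\<lambda>s. B s \<omega>)"
  shows "(\<lambda>(\<omega>, s). B (max 0 s) \<omega>) \<in> borel_measurable (M \<Otimes>\<^sub>M borel)"
proof (rule borel_measurable_LIMSEQ_real)
  \<comment> \<open>Times are rounded down to the grid of mesh \<open>1/(n+1)\<close>. Each
    approximation uses countably many times, hence is jointly measurable; path continuity gives the
    limit.\<close>
  define g where "g n s = real (nat \<lfloor>max 0 s * real (Suc n)\<rfloor>) / real (Suc n)" for n s
  have g_lim: "(\<lambda>n. g n s) \<longlonglongrightarrow> max 0 s" for s
  proof (rule LIM_zero_cancel, rule LIMSEQ_norm_0)
    fix n
    define m where "m = max 0 s * real (Suc n)"
    have "0 \<le> m" by (simp add: m_def)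
    then have "\<bar>real (nat \<lfloor>m\<rfloor>) - m\<bar> < 1" by linarith
    moreover have "g n s - max 0 s = (real (nat \<lfloor>m\<rfloor>) - m) / real (Suc n)"
      unfolding g_def m_def diff_divide_distrib by simp
    ultimately show "norm (g n s - max 0 s) < 1 / real (Suc n)"
      by (simp only: real_norm_def abs_divide) (simp add: divide_strict_right_mono)
  qed
  fix p assume "p \<in> space (M \<Otimes>\<^sub>M (borel :: real measure))"
  then have "fst p \<in> space M" by (auto simp: space_pair_measure)
  from continuous_on_tendsto_compose[OF cont[OF this] g_lim, of "snd p"]
  show "(\<lambda>n. B (g n (snd p)) (fst p)) \<longlonglongrightarrow> (case p of (\<omega>, s) \<Rightarrow> B (max 0 s) \<omega>)"
    by (auto simp: g_def case_prod_beta)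
next
  fix n
  show "(\<lambda>p. B (real (nat \<lfloor>max 0 (snd p) * real (Suc n)\<rfloor>) / real (Suc n)) (fst p))
      \<in> borel_measurable (M \<Otimes>\<^sub>M borel)"
    by (rule measurable_compose_countable
          [where f = "\<lambda>k p. B (real k / real (Suc n)) (fst p)"])
       (auto intro!: measurable_compose[OF measurable_fst meas])
qed

text \<open>Paths are continuous at every sample point, not only almost surely, so the pathwise
  arguments below avoid null sets.\<close>

locale continuous_process = prob_space M for M :: "'w measure" +
  fixes B :: "real \<Rightarrow> 'w \<Rightarrow> real"
  assumes process_measurable: "0 \<le> s \<Longrightarrow> B s \<in> borel_measurable M"
    and process_continuous: "\<omega> \<in> space M \<Longrightarrow> continuous_on {0..} (\<lambda>s. B s \<omega>)"
begin

lemmas measurable_process_pair [measurable] =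
  measurable_pair_continuous_process[OF process_measurable process_continuous, simplified]

text \<open>The displacement of the first component: \<open>B\<close> is the noise added to the
  second coordinate, and the third keeps its initial value.\<close>

definition drift_integral :: "real ^ 3 \<Rightarrow> real \<Rightarrow> 'w \<Rightarrow> real" where
  "drift_integral x t \<omega> = (LINT s:{0..t}|lborel. cos (x $ 3 * exp ((x $ 2 + B s \<omega>) ^ 3)))"

text \<open>The indicator hides the clipping of time, and the clipped process is jointly measurable
  on the whole line, as integration over \<open>s\<close> with a parameter requires.\<close>

lemma drift_integral_eq:
  "drift_integral x t \<omega> =
    (\<integral>s. indicator {0..t} s * cos (x $ 3 * exp ((x $ 2 + B (max 0 s) \<omega>) ^ 3)) \<partial>lborel)"
  unfolding drift_integral_def set_lebesgue_integral_def
  by (intro Bochner_Integration.integral_cong) (auto simp: indicator_def)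

lemma measurable_process_slice:
  "\<omega> \<in> space M \<Longrightarrow> (\<lambda>s. B (max 0 s) \<omega>) \<in> borel_measurable borel"
  using measurable_Pair_compose_split[OF measurable_process_pair measurable_const measurable_ident]
  by simp

lemma borel_measurable_drift_integral: "drift_integral x t \<in> borel_measurable M"
  unfolding drift_integral_eq
proof (rule lborel.borel_measurable_lebesgue_integral)
  have "(\<lambda>(\<omega>, s). indicator {0..t} s * cos (x $ 3 * exp ((x $ 2 + B (max 0 s) \<omega>) ^ 3)))
      \<in> borel_measurable (M \<Otimes>\<^sub>M borel)"
    using measurable_process_pair by measurable
  then show "(\<lambda>(\<omega>, s). indicator {0..t} s * cos (x $ 3 * exp ((x $ 2 + B (max 0 s) \<omega>) ^ 3)))
      \<in> borel_measurable (M \<Otimes>\<^sub>M lborel)"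
    by (simp cong: measurable_cong_sets sets_pair_measure_cong)
qed

lemma drift_integral_integrable:
  assumes "\<omega> \<in> space M"
  shows "set_integrable lborel {0..t} (\<lambda>s. cos (x $ 3 * exp ((x $ 2 + B s \<omega>) ^ 3)))"
  by (intro borel_integrable_atLeastAtMost' continuous_intros
        continuous_on_subset[OF process_continuous[OF assms]]) auto

lemma abs_drift_integral_le:
  assumes "0 \<le> t"
  shows "\<bar>drift_integral x t \<omega>\<bar> \<le> t"
proof -
  have "norm (drift_integral x t \<omega>) \<le> (LINT s|lborel. indicator {0..t} s)"
    unfolding drift_integral_def set_lebesgue_integral_def
    using assms
    by (intro order_trans[OF integral_norm_bound] integral_mono')
      (auto intro: integrable_real_indicator simp: indicator_eq_0_iff abs_mult split: split_indicator)
  then show ?thesis using assms by simp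
qed

lemma tendsto_drift_integral:
  assumes "\<omega> \<in> space M" "0 \<le> t" "xs \<longlonglongrightarrow> x"
  shows "(\<lambda>n. drift_integral (xs n) t \<omega>) \<longlonglongrightarrow> drift_integral x t \<omega>"
  unfolding drift_integral_eq
proof (rule integral_dominated_convergence)
  note [measurable] = measurable_process_slice[OF assms(1)]
  show "(\<lambda>s. indicator {0..t} s * cos (y $ 3 * exp ((y $ 2 + B (max 0 s) \<omega>) ^ 3)))
      \<in> borel_measurable lborel" for y :: "real ^ 3"
    by measurable
  then show "(\<lambda>s. indicator {0..t} s * cos (xs n $ 3 * exp ((xs n $ 2 + B (max 0 s) \<omega>) ^ 3)))
      \<in> borel_measurable lborel" for n .
  show "integrable lborel (indicator {0..t} :: real \<Rightarrow> real)"
    using assms(2) by simp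
  show "AE s in lborel. (\<lambda>n. indicator {0..t} s *
      cos (xs n $ 3 * exp ((xs n $ 2 + B (max 0 s) \<omega>) ^ 3))) \<longlonglongrightarrow>
      indicator {0..t} s * cos (x $ 3 * exp ((x $ 2 + B (max 0 s) \<omega>) ^ 3))"
    by (intro AE_I2 tendsto_intros assms(3))
qed (auto simp: indicator_def)

lemma tendsto_expectation_drift_integral:
  assumes "0 \<le> t" "xs \<longlonglongrightarrow> x"
  shows "(\<lambda>n. expectation (drift_integral (xs n) t)) \<longlonglongrightarrow> expectation (drift_integral x t)"
  by (rule integral_dominated_convergence[where w = "\<lambda>_. t"])
     (auto intro!: borel_measurable_drift_integral tendsto_drift_integral
        abs_drift_integral_le assms)

text \<open>The loss \<open>t - drift_integral x t\<close> is the time integral of a nonnegative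
  function \<open>1 - cos\<close>. Keeping only times in \<open>[t/4, t/2]\<close> with
  \<open>B s\<close> in \<open>[a, b]\<close> leaves an integrand of at least
  \<open>1 - cos 1\<close>. Tonelli then exchanges time and expectation; the factor
  \<open>t/4\<close> is the length of the time window.\<close>

lemma expectation_loss_ge:
  fixes a t p :: real and x :: "real ^ 3"
  defines "b \<equiv> a + 1 / (8 * a\<^sup>2)"
  assumes a: "1 \<le> a" and t: "0 \<le> t" and p: "0 \<le> p"
    and prob: "\<And>s. s \<in> {t/4..t/2} \<Longrightarrow>
      p \<le> prob {\<omega> \<in> space M. B s \<omega> \<in> {a..b} \<and> B t \<omega> \<in> {-1..1}}"
    and x: "x $ 2 = 0" "x $ 3 = exp (- (a ^ 3))"
  shows "t / 4 * (1 - cos 1) * p \<le>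
    expectation (\<lambda>\<omega>. (t - drift_integral x t \<omega>) * indicator {-1..1} (B t \<omega>))"
proof -
  \<comment> \<open>The width of \<open>[a, b]\<close> gives \<open>b\<^sup>3 \<le> a\<^sup>3 + 1\<close>, so the argument of the cosine stays in \<open>[1, e] \<subseteq> [1, \<pi>]\<close>.\<close>
  have cos_le: "cos (exp (- (a ^ 3)) * exp (y ^ 3)) \<le> cos 1" if "y \<in> {a..b}" for y
  proof -
    define d where "d = 1 / (8 * a\<^sup>2)"
    have "0 < d" "d \<le> 1/8" "d * a\<^sup>2 = 1/8"
      using a by (auto simp: d_def field_simps)
    have b: "b ^ 3 = a ^ 3 + 3 * (d * a\<^sup>2) + 3 * (d * a) * d + d ^ 3"
      unfolding b_def d_def[symmetric] by (simp add: power3_eq_cube power2_eq_square algebra_simps)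
    have "d * a \<le> 1/8"
    proof -
      have "d * a \<le> d * a\<^sup>2"
        using a \<open>0 < d\<close> by (intro mult_left_mono) (auto simp: power2_eq_square)
      then show ?thesis using \<open>d * a\<^sup>2 = 1/8\<close> by simp
    qed
    then have "3 * (d * a) * d \<le> 3 * (1/8) * (1/8)"
      using \<open>0 < d\<close> \<open>d \<le> 1/8\<close> a by (intro mult_mono) auto
    moreover have "d ^ 3 \<le> 1/512"
      using \<open>0 < d\<close> \<open>d \<le> 1/8\<close> power_mono[of d "1/8" 3] by (simp add: power_divide)
    ultimately have "b ^ 3 \<le> a ^ 3 + 1"
      unfolding b \<open>d * a\<^sup>2 = 1/8\<close> by linarith
    moreover have "y ^ 3 \<le> b ^ 3" "a ^ 3 \<le> y ^ 3"
      using that a by (auto intro!: power_mono)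
    ultimately have ge: "1 \<le> exp (y ^ 3 - a ^ 3)" and "exp (y ^ 3 - a ^ 3) \<le> exp 1"
      by auto
    with exp_le pi_gt3 have "exp (y ^ 3 - a ^ 3) \<le> pi" by linarith
    with ge have "cos (exp (y ^ 3 - a ^ 3)) \<le> cos 1"
      by (intro cos_monotone_0_pi_le) auto
    then show ?thesis by (simp add: exp_diff exp_minus field_simps)
  qed
  \<comment> \<open>\<open>k\<close> is a minorant of the integrand that keeps only the time window
    and the two events whose joint probability is at least \<open>p\<close>.\<close>
  define k :: "'w \<Rightarrow> real \<Rightarrow> real" where "k \<omega> s = indicator {t/4..t/2} s * ((1 - cos 1) *
      (indicator {a..b} (B (max 0 s) \<omega>) * indicator {-1..1} (B t \<omega>)))" for \<omega> s
  have [measurable]: "B t \<in> borel_measurable M" using process_measurable t by simp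
  have B_pair: "(\<lambda>p. B (max 0 (snd p)) (fst p)) \<in> borel_measurable (M \<Otimes>\<^sub>M borel)"
    using measurable_process_pair by (simp add: case_prod_beta')
  have ind: "(indicator {c..d} :: real \<Rightarrow> real) \<in> borel_measurable borel" for c d :: real
    by simp
  have "(\<lambda>p. k (fst p) (snd p)) \<in> borel_measurable (M \<Otimes>\<^sub>M borel)"
    unfolding k_def
    by (intro borel_measurable_times borel_measurable_const
          measurable_compose[OF measurable_snd ind] measurable_compose[OF B_pair ind]
          measurable_compose[OF measurable_compose[OF measurable_fst \<open>B t \<in> borel_measurable M\<close>] ind])
  then have "case_prod k \<in> borel_measurable (M \<Otimes>\<^sub>M borel)"
    by (simp add: case_prod_beta')
  then have k_meas: "case_prod k \<in> borel_measurable (M \<Otimes>\<^sub>M lborel)"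
    by (simp cong: measurable_cong_sets sets_pair_measure_cong)
  interpret P: pair_sigma_finite M lborel ..
  have k_le: "(\<integral>\<^sup>+s. ennreal (k \<omega> s) \<partial>lborel) \<le>
      ennreal ((t - drift_integral x t \<omega>) * indicator {-1..1} (B t \<omega>))"
    if \<omega>: "\<omega> \<in> space M" for \<omega>
  proof -
    let ?q = "\<lambda>s. 1 - cos (x $ 3 * exp ((x $ 2 + B s \<omega>) ^ 3))"
    have int: "set_integrable lborel {0..t} ?q"
      using t by (intro set_integral_diff drift_integral_integrable \<omega>)
        (simp add: set_integrable_def)
    have "t - drift_integral x t \<omega> = (LINT s:{0..t}|lborel. ?q s)"
      unfolding drift_integral_def
      using t by (subst set_integral_diff(2)[OF _ drift_integral_integrable[OF \<omega>]])
        (auto simp: set_integrable_def set_lebesgue_integral_def)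
    then have "ennreal ((t - drift_integral x t \<omega>) * indicator {-1..1} (B t \<omega>)) =
        (\<integral>\<^sup>+s. ennreal (indicator {0..t} s * ?q s * indicator {-1..1} (B t \<omega>)) \<partial>lborel)"
      using int unfolding set_integrable_def set_lebesgue_integral_def
      by (subst nn_integral_eq_integral) (auto simp: indicator_def)
    moreover have "k \<omega> s \<le> indicator {0..t} s * ?q s * indicator {-1..1} (B t \<omega>)" for s
      using cos_le[of "B s \<omega>"] t by (auto simp: k_def x indicator_def)
    ultimately show ?thesis
      by (auto intro!: nn_integral_mono ennreal_leI)
  qed
  have int: "integrable M (\<lambda>\<omega>. (t - drift_integral x t \<omega>) * indicator {-1..1} (B t \<omega>))"
  proof (rule integrable_const_bound[where B = "2 * t"])
    show "AE \<omega> in M. norm ((t - drift_integral x t \<omega>) * indicator {-1..1} (B t \<omega>)) \<le> 2 * t"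
      using abs_drift_integral_le[OF t, of x] t
      by (intro AE_I2) (auto simp: indicator_def abs_le_iff)
  qed (use borel_measurable_drift_integral[of x t] in measurable)
  have "ennreal (t / 4 * (1 - cos 1) * p) =
      (\<integral>\<^sup>+s. ennreal ((1 - cos 1) * p) * indicator {t/4..t/2} s \<partial>lborel)"
  proof -
    have "ennreal (t / 4 * (1 - cos 1) * p) = ennreal (((1 - cos 1) * p) * (t / 4))"
      by (simp only: ac_simps)
    also have "\<dots> = ennreal ((1 - cos 1) * p) * ennreal (t / 4)"
      using t p by (intro ennreal_mult) auto
    also have "ennreal (t / 4) = emeasure lborel {t/4..t/2}"
      using t by simp
    finally show ?thesis by (subst nn_integral_cmult_indicator) auto
  qed
  also have "\<dots> \<le> (\<integral>\<^sup>+s. (\<integral>\<^sup>+\<omega>. ennreal (k \<omega> s) \<partial>M) \<partial>lborel)"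
  proof (rule nn_integral_mono)
    fix s
    show "ennreal ((1 - cos 1) * p) * indicator {t/4..t/2} s \<le> (\<integral>\<^sup>+\<omega>. ennreal (k \<omega> s) \<partial>M)"
    proof (cases "s \<in> {t/4..t/2}")
      case True
      then have s: "0 \<le> s" using t by auto
      then have [measurable]: "B s \<in> borel_measurable M" by (rule process_measurable)
      let ?E = "{\<omega> \<in> space M. B s \<omega> \<in> {a..b} \<and> B t \<omega> \<in> {-1..1}}"
      have "(\<integral>\<^sup>+\<omega>. ennreal (k \<omega> s) \<partial>M) = (\<integral>\<^sup>+\<omega>. ennreal (1 - cos 1) * indicator ?E \<omega> \<partial>M)"
        using True s by (intro nn_integral_cong) (auto simp: k_def indicator_def)
      also have "\<dots> = ennreal (1 - cos 1) * emeasure M ?E"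
        by (intro nn_integral_cmult_indicator) measurable
      also have "\<dots> = ennreal ((1 - cos 1) * prob ?E)"
        by (simp add: emeasure_eq_measure ennreal_mult)
      finally show ?thesis
        using prob[OF True] True by (auto intro!: ennreal_leI mult_left_mono)
    qed simp
  qed
  also have "\<dots> = (\<integral>\<^sup>+\<omega>. (\<integral>\<^sup>+s. ennreal (k \<omega> s) \<partial>lborel) \<partial>M)"
    using measurable_compose[OF k_meas measurable_ennreal]
    by (intro P.Fubini') (simp add: case_prod_beta')
  also have "\<dots> \<le> (\<integral>\<^sup>+\<omega>. ennreal ((t - drift_integral x t \<omega>) * indicator {-1..1} (B t \<omega>)) \<partial>M)"
    by (intro nn_integral_mono k_le)
  also have "\<dots> = ennreal (expectation (\<lambda>\<omega>. (t - drift_integral x t \<omega>) * indicator {-1..1} (B t \<omega>)))"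
    using abs_drift_integral_le[OF t, of x]
    by (intro nn_integral_eq_integral int) (auto simp: abs_le_iff)
  \<comment> \<open>Leaving \<open>ennreal\<close> uses that the expected loss is nonnegative, by
    \<open>drift_integral x t \<omega> \<le> t\<close>.\<close>
  finally show ?thesis
    using abs_drift_integral_le[OF t, of x]
    by (subst (asm) ennreal_le_iff) (auto simp: abs_le_iff intro!: Bochner_Integration.integral_nonneg)
qed

end

subsection \<open>Brownian motion\<close>

text \<open>Irregularity at the single point \<open>x\<close> suffices. Displacements of length
  \<open>h = exp (-a^3)\<close> eventually stay in any neighbourhood, and a Hoelder bound would
  force \<open>\<rho> a \<le> C h^\<alpha> = C exp (-\<alpha> a^3)\<close>.\<close>

lemma not_locally_hoelderI:
  fixes F :: "'a::real_normed_vector \<Rightarrow> 'b::metric_space"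
  assumes "norm e = 1"
    and lower: "\<And>a. 1 \<le> a \<Longrightarrow> \<rho> a \<le> dist (F (x + exp (- (a ^ 3)) *\<^sub>R e)) (F x)"
    and \<rho>: "\<And>\<alpha>. 0 < \<alpha> \<Longrightarrow> filterlim (\<lambda>a. \<rho> a * exp (\<alpha> * a ^ 3)) at_top at_top"
  shows "\<not> locally_hoelder F"
proof
  assume "locally_hoelder F"
  then obtain U \<alpha> C where "open U" "x \<in> U" "0 < \<alpha>"
    and C: "\<And>y z. y \<in> U \<Longrightarrow> z \<in> U \<Longrightarrow> dist (F y) (F z) \<le> C * dist y z powr \<alpha>"
    unfolding locally_hoelder_def hoelder_on_def by metis
  have "((\<lambda>a::real. x + exp (- (a ^ 3)) *\<^sub>R e) \<longlongrightarrow> x + 0 *\<^sub>R e) at_top"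
    by (intro tendsto_intros) real_asymp
  then have "\<forall>\<^sub>F a::real in at_top. x + exp (- (a ^ 3)) *\<^sub>R e \<in> U"
    using \<open>open U\<close> \<open>x \<in> U\<close> by (simp add: topological_tendstoD)
  moreover have "\<forall>\<^sub>F a in at_top. C < \<rho> a * exp (\<alpha> * a ^ 3)"
    using \<rho>[OF \<open>0 < \<alpha>\<close>] by (simp add: filterlim_at_top_dense)
  ultimately have "\<forall>\<^sub>F a::real in at_top. False"
    using eventually_ge_at_top[of 1]
  proof eventually_elim
    case (elim a)
    have "\<rho> a \<le> C * exp (- (a ^ 3)) powr \<alpha>"
      using lower[OF elim(3)] C[OF elim(1) \<open>x \<in> U\<close>] \<open>norm e = 1\<close> by (simp add: dist_norm)
    also have "exp (- (a ^ 3)) powr \<alpha> = inverse (exp (\<alpha> * a ^ 3))"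
      by (simp add: powr_def exp_minus[symmetric])
    finally have "\<rho> a \<le> C / exp (\<alpha> * a ^ 3)"
      by (simp add: divide_inverse)
    with elim(2) show False by (simp add: field_simps)
  qed
  then show False by simp
qed

text \<open>The density is bounded below by its worst case on the interval:
  \<open>|sqrt 2 * y| \<le> c\<close> and \<open>v \<ge> t/4\<close> bound the exponent by
  \<open>c^2/t\<close>, while \<open>v \<le> t\<close> controls the normalizing factor. Tying
  \<open>v\<close> to \<open>t\<close> lets one bound serve for the increments before and after an
  intermediate time.\<close>

lemma normal_prob_interval_ge:
  fixes Z :: "'w \<Rightarrow> real"
  assumes "prob_space M" and Z: "distributed M lborel Z (normal_density 0 (sqrt v))"
    and v: "0 < v" "t / 4 \<le> v" "v \<le> t"
    and ab: "a \<le> b" "\<bar>a\<bar> \<le> c" "\<bar>b\<bar> \<le> c"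
  shows "(b - a) * exp (- (c\<^sup>2 / t)) / sqrt (4 * pi * t) \<le>
    measure M {\<omega> \<in> space M. sqrt 2 * Z \<omega> \<in> {a..b}}"
proof -
  interpret prob_space M by fact
  let ?l = "exp (- (c\<^sup>2 / t)) / sqrt (2 * pi * t)" and ?I = "{a / sqrt 2..b / sqrt 2}"
  have t: "0 < t" using v by simp
  have density_ge: "?l \<le> normal_density 0 (sqrt v) y" if "y \<in> ?I" for y
  proof -
    have "a \<le> sqrt 2 * y" "sqrt 2 * y \<le> b" using that by (auto simp: pos_divide_le_eq pos_le_divide_eq mult.commute)
    then have "\<bar>sqrt 2 * y\<bar> \<le> c" using ab by linarith
    then have "(sqrt 2 * y)\<^sup>2 \<le> c\<^sup>2" by (rule abs_le_square_iff[THEN iffD1, OF order_trans]) simp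
    then have "2 * y\<^sup>2 \<le> c\<^sup>2" by (simp add: power_mult_distrib)
    then have "y\<^sup>2 / (2 * v) \<le> (c\<^sup>2 / 2) / (2 * (t / 4))"
      using v t by (intro frac_le) auto
    then have "exp (- (c\<^sup>2 / t)) \<le> exp (- (y\<^sup>2 / (2 * v)))" by simp
    moreover have "1 / sqrt (2 * pi * t) \<le> 1 / sqrt (2 * pi * v)"
      using v t by (intro frac_le) auto
    ultimately have "1 / sqrt (2 * pi * t) * exp (- (c\<^sup>2 / t)) \<le>
        1 / sqrt (2 * pi * v) * exp (- (y\<^sup>2 / (2 * v)))"
      using v by (intro mult_mono) auto
    then show ?thesis using v by (simp add: normal_density_def)
  qed
  have "ennreal (?l * (b / sqrt 2 - a / sqrt 2)) = (\<integral>\<^sup>+y. ennreal ?l * indicator ?I y \<partial>lborel)"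
    using ab t by (subst nn_integral_cmult_indicator) (auto simp: divide_right_mono ennreal_mult[symmetric])
  also have "\<dots> \<le> (\<integral>\<^sup>+y. ennreal (normal_density 0 (sqrt v) y) * indicator ?I y \<partial>lborel)"
    using density_ge by (intro nn_integral_mono) (auto simp: indicator_def intro!: ennreal_leI)
  also have "\<dots> = emeasure M (Z -` ?I \<inter> space M)"
    by (rule distributed_emeasure[OF Z, symmetric]) simp
  also have "Z -` ?I \<inter> space M = {\<omega> \<in> space M. sqrt 2 * Z \<omega> \<in> {a..b}}"
    by (auto simp: pos_divide_le_eq pos_le_divide_eq mult.commute)
  finally have "?l * (b / sqrt 2 - a / sqrt 2) \<le> prob {\<omega> \<in> space M. sqrt 2 * Z \<omega> \<in> {a..b}}"
    by (simp add: emeasure_eq_measure)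
  moreover have "sqrt (4 * pi * t) = sqrt (2 * pi * t) * sqrt 2"
    by (simp add: real_sqrt_mult[symmetric])
  ultimately show ?thesis
    by (simp only: diff_divide_distrib[symmetric] times_divide_times_eq mult.commute[of "exp _"])
qed

lemma brownian_increment_distributed:
  assumes "standard_brownian_motion M W" "0 \<le> r" "r < u"
  shows "distributed M lborel (\<lambda>\<omega>. W u \<omega> - W r \<omega>) (normal_density 0 (sqrt (u - r)))"
  using assms by (simp add: standard_brownian_motion_def)

text \<open>Reaching \<open>[a, b]\<close> at time \<open>s\<close> and coming back by time
  \<open>t\<close> are governed by independent increments. Both durations \<open>s\<close> and
  \<open>t - s\<close> lie in \<open>[t/4, t]\<close>, so the two probabilities share one lower
  bound; hence the square.\<close>

lemma brownian_return_prob_ge: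
  assumes W: "standard_brownian_motion M W"
    and s: "0 < t" "t / 4 \<le> s" "s \<le> t / 2" and ab: "0 \<le> a" "a \<le> b" "b \<le> a + 1"
  shows "((b - a) * exp (- (b\<^sup>2 / t)) / sqrt (4 * pi * t))\<^sup>2 \<le>
    measure M {\<omega> \<in> space M. sqrt 2 * (W s \<omega> - W 0 \<omega>) \<in> {a..b} \<and>
      sqrt 2 * (W t \<omega> - W 0 \<omega>) \<in> {-1..1}}"
proof -
  interpret prob_space M using W by (simp add: standard_brownian_motion_def)
  have [measurable]: "W 0 \<in> borel_measurable M" "W s \<in> borel_measurable M" "W t \<in> borel_measurable M"
    using W s by (auto simp: standard_brownian_motion_def)
  define \<tau> :: "nat \<Rightarrow> real" where "\<tau> i = (if i = 0 then 0 else if i = 1 then s else t)" for i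
  let ?A = "\<lambda>i::nat. if i = 0 then {a / sqrt 2..b / sqrt 2} else {- b / sqrt 2..- a / sqrt 2}"
  let ?D = "\<lambda>i \<omega>. W (\<tau> (Suc i)) \<omega> - W (\<tau> i) \<omega>"
  let ?p = "(b - a) * exp (- (b\<^sup>2 / t)) / sqrt (4 * pi * t)"
  let ?E1 = "{\<omega> \<in> space M. sqrt 2 * (W s \<omega> - W 0 \<omega>) \<in> {a..b}}"
  \<comment> \<open>After entering \<open>[a, b]\<close> at time \<open>s\<close>, an increment in \<open>[-b, -a]\<close> returns to \<open>[a - b, b - a]\<close>.\<close>
  let ?E2 = "{\<omega> \<in> space M. sqrt 2 * (W t \<omega> - W s \<omega>) \<in> {-b..-a}}"
  have "0 \<le> \<tau> 0 \<and> (\<forall>i<2. \<tau> i < \<tau> (Suc i))"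
    using s by (auto simp: \<tau>_def less_2_cases_iff)
  then have "indep_vars (\<lambda>_. borel) ?D {..<2}"
    using W unfolding standard_brownian_motion_def by blast
  then have "prob (\<Inter>i\<in>{..<2}. ?D i -` ?A i \<inter> space M) = (\<Prod>i\<in>{..<2}. prob (?D i -` ?A i \<inter> space M))"
    by (intro indep_varsD) (auto simp: lessThan_empty_iff)
  moreover have "?D 0 -` ?A 0 \<inter> space M = ?E1" "?D 1 -` ?A 1 \<inter> space M = ?E2"
    by (auto simp: \<tau>_def pos_divide_le_eq pos_le_divide_eq mult.commute
        simp del: divide_minus_left)
  ultimately have indep: "prob (?E1 \<inter> ?E2) = prob ?E1 * prob ?E2"
    by (simp add: numeral_2_eq_2 lessThan_Suc Int_commute mult.commute)
  from brownian_increment_distributed[OF W, of 0 s] brownian_increment_distributed[OF W, of s t] s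
  have "?p \<le> prob ?E1" "?p \<le> prob ?E2"
    using normal_prob_interval_ge[OF prob_space_axioms, of "\<lambda>\<omega>. W s \<omega> - W 0 \<omega>" s t a b b]
      normal_prob_interval_ge[OF prob_space_axioms, of "\<lambda>\<omega>. W t \<omega> - W s \<omega>" "t - s" t "-b" "-a" b]
      s ab by auto
  then have "?p * ?p \<le> prob ?E1 * prob ?E2"
    using s ab by (intro mult_mono) auto
  also have "\<dots> \<le> prob {\<omega> \<in> space M. sqrt 2 * (W s \<omega> - W 0 \<omega>) \<in> {a..b} \<and>
      sqrt 2 * (W t \<omega> - W 0 \<omega>) \<in> {-1..1}}"
    unfolding indep[symmetric]
  proof (rule finite_measure_mono)
    \<comment> \<open>Here \<open>b - a \<le> 1\<close> puts \<open>[a - b, b - a]\<close> inside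
      \<open>[-1, 1]\<close>.\<close>
    show "?E1 \<inter> ?E2 \<subseteq> {\<omega> \<in> space M. sqrt 2 * (W s \<omega> - W 0 \<omega>) \<in> {a..b} \<and>
        sqrt 2 * (W t \<omega> - W 0 \<omega>) \<in> {-1..1}}"
      using ab by (auto simp: algebra_simps)
  qed measurable
  finally show ?thesis by (simp add: power2_eq_square)
qed

subsection \<open>The counterexample\<close>

lemma drift_eq: "drift z = cos (z $ 3 * exp ((z $ 2) ^ 3)) *\<^sub>R axis 1 1"
  by (simp add: drift_def vec_eq_iff forall_3 axis_def)

lemma diffusion_eq: "diffusion = sqrt 2 *\<^sub>R axis 2 1"
  by (simp add: diffusion_def vec_eq_iff forall_3 axis_def)

text \<open>The system decouples: the drift acts only along axis 1 and the noise only along axis 2,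
  so the second and third components are explicit and can be inserted into the cosine.\<close>

lemma drift_SDE_solution_AE:
  assumes "additive_noise_SDE_solution M W drift diffusion x Y"
  shows "AE \<omega> in M. \<forall>t\<ge>0. Y t \<omega> = x + (LINT s:{0..t}|lborel.
    cos (x $ 3 * exp ((x $ 2 + sqrt 2 * (W s \<omega> - W 0 \<omega>)) ^ 3))) *\<^sub>R axis 1 1 +
    (sqrt 2 * (W t \<omega> - W 0 \<omega>)) *\<^sub>R axis 2 1"
proof -
  have cont: "\<And>\<omega>. \<omega> \<in> space M \<Longrightarrow> continuous_on {0..} (\<lambda>t. Y t \<omega>)"
    and ae: "AE \<omega> in M. Y 0 \<omega> = x" "AE \<omega> in M. \<forall>t\<ge>0.
        set_integrable lborel {0..t} (\<lambda>s. drift (Y s \<omega>)) \<and>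
        Y t \<omega> = Y 0 \<omega> + (LINT s:{0..t}|lborel. drift (Y s \<omega>)) + (W t \<omega> - W 0 \<omega>) *\<^sub>R diffusion"
    using assms unfolding additive_noise_SDE_solution_def by auto
  from ae AE_space show ?thesis
  proof eventually_elim
    case (elim \<omega>)
    let ?c = "\<lambda>s. cos (Y s \<omega> $ 3 * exp ((Y s \<omega> $ 2) ^ 3))"
    have Y: "Y t \<omega> = x + (LINT s:{0..t}|lborel. ?c s) *\<^sub>R axis 1 1 +
        (sqrt 2 * (W t \<omega> - W 0 \<omega>)) *\<^sub>R axis 2 1" if "0 \<le> t" for t
    proof -
      have "set_integrable lborel {0..t} ?c"
        by (intro borel_integrable_atLeastAtMost' continuous_intros
              continuous_on_subset[OF cont[OF elim(3)]]) auto
      then have "(LINT s:{0..t}|lborel. drift (Y s \<omega>)) = (LINT s:{0..t}|lborel. ?c s) *\<^sub>R axis 1 1"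
        unfolding drift_eq set_integrable_def set_lebesgue_integral_def
        by (subst integral_scaleR_left[symmetric]) auto
      moreover have "Y t \<omega> = Y 0 \<omega> + (LINT s:{0..t}|lborel. drift (Y s \<omega>)) + (W t \<omega> - W 0 \<omega>) *\<^sub>R diffusion"
        using elim(2) that by blast
      ultimately show ?thesis
        by (simp only: elim(1) diffusion_eq scaleR_scaleR mult.commute[of "sqrt 2"])
    qed
    \<comment> \<open>The integral still containing \<open>Y\<close> sits on axis 1, so components 2
      and 3 can be read off before it is evaluated.\<close>
    have "Y s \<omega> $ 2 = x $ 2 + sqrt 2 * (W s \<omega> - W 0 \<omega>)" "Y s \<omega> $ 3 = x $ 3" if "0 \<le> s" for s
      by (simp_all add: Y[OF that] axis_def)
    then have "(LINT s:{0..t}|lborel. ?c s) = (LINT s:{0..t}|lborel.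
        cos (x $ 3 * exp ((x $ 2 + sqrt 2 * (W s \<omega> - W 0 \<omega>)) ^ 3)))" for t
      by (intro set_lebesgue_integral_cong) auto
    with Y show ?case by presburger
  qed
qed

lemma axis_3_nth:
  "(axis i c :: 'a::zero ^ 3) $ 1 = (if i = 1 then c else 0)"
  "(axis i c :: 'a::zero ^ 3) $ 2 = (if i = 2 then c else 0)"
  "(axis i c :: 'a::zero ^ 3) $ 3 = (if i = 3 then c else 0)"
  by (auto simp: axis_def)

lemma inner_vec_3: "(x :: real ^ 3) \<bullet> x = (x $ 1)\<^sup>2 + (x $ 2)\<^sup>2 + (x $ 3)\<^sup>2"
  by (simp add: inner_vec_def sum_3 power2_eq_square)

text \<open>The bound of \<open>expectation_loss_ge\<close> with \<open>p\<close> taken from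
  \<open>brownian_return_prob_ge\<close> at \<open>b = a + 1/(8a^2)\<close>.\<close>

definition loss_bound :: "real \<Rightarrow> real \<Rightarrow> real" where
  "loss_bound t a = t / 4 * (1 - cos 1) *
    (1 / (8 * a\<^sup>2) * exp (- ((a + 1 / (8 * a\<^sup>2))\<^sup>2 / t)) / sqrt (4 * pi * t))\<^sup>2"

text \<open>Apart from powers of \<open>a\<close>, the bound decays like
  \<open>exp (-2 a^2 / t)\<close>, so the cubic exponent wins for every
  \<open>\<alpha> > 0\<close>.\<close>

lemma loss_bound_filterlim:
  assumes "0 < t" "0 < c" "0 < \<alpha>"
  shows "filterlim (\<lambda>a. c * loss_bound t a * exp (\<alpha> * a ^ 3)) at_top at_top"
proof -
  \<comment> \<open>\<open>k\<close> collects the positive factors free of \<open>a\<close>;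
    squaring has removed the root in \<open>sqrt (4 * pi * t)\<close>.\<close>
  define k where "k = c * (t / 4 * (1 - cos 1)) / (4 * pi * t)"
  have "cos 1 < (1::real)" using cos_monotone_0_pi[of 0 1] pi_gt3 by simp
  then have "0 < k" using assms by (simp add: k_def)
  have "filterlim (\<lambda>a. k * (1 / (8 * a\<^sup>2) * exp (- ((a + 1 / (8 * a\<^sup>2))\<^sup>2 / t)))\<^sup>2 * exp (\<alpha> * a ^ 3))
      at_top at_top"
    using \<open>0 < k\<close> assms by real_asymp
  moreover have "c * loss_bound t a * exp (\<alpha> * a ^ 3) =
      k * (1 / (8 * a\<^sup>2) * exp (- ((a + 1 / (8 * a\<^sup>2))\<^sup>2 / t)))\<^sup>2 * exp (\<alpha> * a ^ 3)" for a
    using assms by (simp add: loss_bound_def k_def power_divide power_mult_distrib mult_ac)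
  ultimately show ?thesis by simp
qed

theorem theorem3p1:
  fixes M :: "'w measure"
    and W :: "real \<Rightarrow> 'w \<Rightarrow> real"
    and T :: real
    and X :: "real ^ 3 \<Rightarrow> real \<Rightarrow> 'w \<Rightarrow> real ^ 3"
  assumes "prob_space M"
    and "standard_brownian_motion M W"
    and "0 < T"
    and "\<And>x. additive_noise_SDE_solution M W drift diffusion x (X x)"
  shows "\<exists>\<phi> :: real ^ 3 \<Rightarrow> real.
           infinitely_differentiable \<phi> \<and> compactly_supported \<phi> \<and>
           (\<forall>t\<in>{0<..T}.
              continuous_on UNIV (\<lambda>x. prob_space.expectation M (X x t)) \<and>
              \<not> locally_hoelder (\<lambda>x. prob_space.expectation M (X x t)) \<and>
              continuous_on UNIV (\<lambda>x. prob_space.expectation M (\<lambda>\<omega>. \<phi> (X x t \<omega>))) \<and>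
              \<not> locally_hoelder (\<lambda>x. prob_space.expectation M (\<lambda>\<omega>. \<phi> (X x t \<omega>))))"
proof -
  interpret prob_space M by fact
  \<comment> \<open>\<open>B\<close> is read from \<open>X 0\<close> instead of \<open>W\<close>,
    because solution paths are continuous at every sample point while those of \<open>W\<close> are
    so only almost surely.\<close>
  define B where "B s \<omega> = X 0 s \<omega> $ 2" for s \<omega>
  have X_meas: "X x s \<in> borel_measurable M" if "0 \<le> s" for x s
    using assms(4)[of x] that by (simp add: additive_noise_SDE_solution_def)
  interpret continuous_process M B
  proof
    show "B s \<in> borel_measurable M" if "0 \<le> s" for s
      unfolding B_def
      by (rule borel_measurable_continuous_on[OF _ X_meas[OF that]]) (intro continuous_intros)
    show "continuous_on {0..} (\<lambda>s. B s \<omega>)" if "\<omega> \<in> space M" for \<omega>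
      unfolding B_def using assms(4)[of 0] that
      by (auto simp: additive_noise_SDE_solution_def intro!: continuous_intros)
  qed
  have B_AE: "AE \<omega> in M. \<forall>s\<ge>0. B s \<omega> = sqrt 2 * (W s \<omega> - W 0 \<omega>)"
    using drift_SDE_solution_AE[OF assms(4)[of 0]]
    by eventually_elim (simp add: B_def axis_3_nth)
  \<comment> \<open>\<open>Z\<close> is an explicit version of \<open>X\<close>, given at every
    sample point and with a single \<open>B\<close> for all starting points.\<close>
  define Z where "Z x t \<omega> = x + drift_integral x t \<omega> *\<^sub>R axis 1 1 + B t \<omega> *\<^sub>R axis 2 1" for x t \<omega>
  have X_AE: "AE \<omega> in M. X x t \<omega> = Z x t \<omega>" if "0 \<le> t" for x t
    using drift_SDE_solution_AE[OF assms(4)[of x]] B_AE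
  proof eventually_elim
    case (elim \<omega>)
    have "drift_integral x t \<omega> = (LINT s:{0..t}|lborel.
        cos (x $ 3 * exp ((x $ 2 + sqrt 2 * (W s \<omega> - W 0 \<omega>)) ^ 3)))"
      unfolding drift_integral_def using elim(2) by (intro set_lebesgue_integral_cong) auto
    then show ?case using elim that by (simp add: Z_def)
  qed
  have Z_meas: "Z x t \<in> borel_measurable M" if "0 \<le> t" for x t
    unfolding Z_def using borel_measurable_drift_integral[of x t] process_measurable[OF that]
    by measurable
  \<comment> \<open>For \<open>t \<le> T\<close> and \<open>|B t| \<le> 1\<close> the squared norms
    occurring below are at most \<open>9 T^2 + 1 + 1\<close>, which leaves
    \<open>R - |Z|^2 \<ge> 1\<close>. The choice depends on \<open>T\<close> only, so one
    \<open>\<phi>\<close> serves all times.\<close>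
  define R where "R = 9 * T\<^sup>2 + 3"
  have "3 \<le> R" by (simp add: R_def)
  define \<phi> where "\<phi> x = flat_exp 1 (R - x \<bullet> x)" for x :: "real ^ 3"
  have \<phi>_cont: "continuous_on UNIV \<phi>"
    unfolding \<phi>_def by (auto intro!: continuous_intros continuous_on_compose2[OF continuous_on_flat_exp])
  have \<phi>_bounded: "norm (\<phi> x) \<le> 1" for x
    by (simp add: \<phi>_def flat_exp_1_bounds)
  have \<phi>_meas: "(\<lambda>\<omega>. \<phi> (Z x t \<omega>)) \<in> borel_measurable M" if "0 \<le> t" for x t
    by (rule borel_measurable_continuous_on[OF \<phi>_cont Z_meas[OF that]])
  show ?thesis
  proof (intro exI[of _ \<phi>] conjI ballI)
    show "infinitely_differentiable \<phi>"
      unfolding \<phi>_def by (rule infinitely_differentiable_flat_exp_norm)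
    show "compactly_supported \<phi>"
      unfolding \<phi>_def by (rule compactly_supported_flat_exp_norm) (use \<open>3 \<le> R\<close> in simp)
  next
    fix t assume "t \<in> {0<..T}"
    then have t: "0 < t" "t \<le> T" "0 \<le> t" by auto
    note abs_le = abs_drift_integral_le[OF t(3), unfolded abs_le_iff]
    have A_int: "integrable M (drift_integral x t)" for x
      by (rule integrable_const_bound[where B = t])
         (auto intro!: abs_drift_integral_le t borel_measurable_drift_integral)
    \<comment> \<open>\<open>B t\<close> is unbounded; its integrability comes from the first moment
      of the normal increment.\<close>
    from distributed_integrable[OF brownian_increment_distributed[OF assms(2), of 0 t], of "\<lambda>y. y"]
    have "integrable M (\<lambda>\<omega>. W t \<omega> - W 0 \<omega>)"
      using integrable_normal_moment_nz_1[of "sqrt t" 0] t by simp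
    then have "integrable M (\<lambda>\<omega>. sqrt 2 * (W t \<omega> - W 0 \<omega>))" by simp
    then have B_int: "integrable M (B t)"
      by (rule integrable_cong_AE_imp)
         (use B_AE process_measurable[OF t(3)] t in \<open>auto elim!: eventually_mono\<close>)
    have EX: "expectation (X x t) = x + expectation (drift_integral x t) *\<^sub>R axis 1 1 +
        expectation (B t) *\<^sub>R axis 2 1" for x
    proof -
      have "expectation (X x t) = expectation (Z x t)"
        using X_AE[OF t(3)] X_meas[OF t(3)] Z_meas[OF t(3)] by (intro integral_cong_AE) auto
      then show ?thesis
        unfolding Z_def using A_int[of x] B_int by (simp add: prob_space)
    qed
    have E\<phi>: "expectation (\<lambda>\<omega>. \<phi> (X x t \<omega>)) = expectation (\<lambda>\<omega>. \<phi> (Z x t \<omega>))" for x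
    proof (rule integral_cong_AE)
      show "AE \<omega> in M. \<phi> (X x t \<omega>) = \<phi> (Z x t \<omega>)"
        using X_AE[OF t(3), of x] by eventually_elim simp
    qed (auto intro!: borel_measurable_continuous_on[OF \<phi>_cont] X_meas Z_meas t)

    \<comment> \<open>Continuity in the initial value\<close>
    show "continuous_on UNIV (\<lambda>x. expectation (X x t))"
      unfolding EX
      by (intro continuous_on_sequentiallyI tendsto_intros tendsto_expectation_drift_integral t)
    show "continuous_on UNIV (\<lambda>x. expectation (\<lambda>\<omega>. \<phi> (X x t \<omega>)))"
      unfolding E\<phi>
    proof (rule continuous_on_sequentiallyI)
      fix xs :: "nat \<Rightarrow> real ^ 3" and x
      assume "xs \<longlonglongrightarrow> x"
      then have "(\<lambda>n. Z (xs n) t \<omega>) \<longlonglongrightarrow> Z x t \<omega>" if "\<omega> \<in> space M" for \<omega>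
        unfolding Z_def by (intro tendsto_intros tendsto_drift_integral that t)
      then have "(\<lambda>n. \<phi> (Z (xs n) t \<omega>)) \<longlonglongrightarrow> \<phi> (Z x t \<omega>)" if "\<omega> \<in> space M" for \<omega>
        using that by (intro continuous_on_tendsto_compose[OF \<phi>_cont]) auto
      then show "(\<lambda>n. expectation (\<lambda>\<omega>. \<phi> (Z (xs n) t \<omega>))) \<longlonglongrightarrow> expectation (\<lambda>\<omega>. \<phi> (Z x t \<omega>))"
        by (intro integral_dominated_convergence[where w = "\<lambda>_. 1"])
           (auto intro!: \<phi>_meas \<phi>_bounded[unfolded real_norm_def] t)
    qed

    \<comment> \<open>With first coordinate \<open>-2T\<close> the first component ends in
      \<open>[-3T, -T]\<close>, where a loss moves it away from \<open>0\<close>. Third coordinate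
      \<open>0\<close> makes the cosine constantly \<open>1\<close>, so the integral has its maximal
      value \<open>t\<close>.\<close>
    define x0 :: "real ^ 3" where "x0 = (- 2 * T) *\<^sub>R axis 1 1"
    have x0_nth: "x0 $ 1 = - 2 * T" "x0 $ 2 = 0" "x0 $ 3 = 0"
      by (simp_all add: x0_def axis_3_nth)
    define xa where "xa a = x0 + exp (- (a ^ 3)) *\<^sub>R axis 3 1" for a :: real
    have drift_x0: "drift_integral x0 t = (\<lambda>_. t)"
      using t by (simp add: fun_eq_iff drift_integral_def set_lebesgue_integral_def x0_def axis_3_nth)

    \<comment> \<open>Expected loss under a shift of the third coordinate\<close>
    let ?loss = "\<lambda>a \<omega>. (t - drift_integral (xa a) t \<omega>) * indicator {-1..1} (B t \<omega>)"
    have loss_int: "integrable M (?loss a)" for a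
    proof (rule integrable_const_bound[where B = "2 * t"])
      show "AE \<omega> in M. norm (?loss a \<omega>) \<le> 2 * t"
        using abs_le[of "xa a"] t
        by (intro AE_I2) (auto simp: indicator_def abs_le_iff)
    qed (use borel_measurable_drift_integral[of "xa a" t] process_measurable[OF t(3)] in measurable)
    have loss_ge: "loss_bound t a \<le> expectation (?loss a)" if "1 \<le> a" for a
      unfolding loss_bound_def
    proof (rule expectation_loss_ge)
      let ?b = "a + 1 / (8 * a\<^sup>2)"
      fix s assume s: "s \<in> {t/4..t/2}"
      have "0 \<le> s" using s t by auto
      have [measurable]: "W 0 \<in> borel_measurable M" "W s \<in> borel_measurable M" "W t \<in> borel_measurable M"
        using assms(2) \<open>0 \<le> s\<close> t by (auto simp: standard_brownian_motion_def)
      have "1 \<le> a\<^sup>2" using that by simp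
      then have "1 / (8 * a\<^sup>2) \<le> 1" by (subst divide_le_eq_1_pos; linarith)
      have "((?b - a) * exp (- (?b\<^sup>2 / t)) / sqrt (4 * pi * t))\<^sup>2 \<le>
          prob {\<omega> \<in> space M. sqrt 2 * (W s \<omega> - W 0 \<omega>) \<in> {a..?b} \<and>
            sqrt 2 * (W t \<omega> - W 0 \<omega>) \<in> {-1..1}}"
        by (rule brownian_return_prob_ge[OF assms(2)])
           (use s t that \<open>1 / (8 * a\<^sup>2) \<le> 1\<close> in auto)
      also have "\<dots> = prob {\<omega> \<in> space M. B s \<omega> \<in> {a..?b} \<and> B t \<omega> \<in> {-1..1}}"
      proof (rule finite_measure_eq_AE)
        note [measurable] = process_measurable[OF \<open>0 \<le> s\<close>] process_measurable[OF t(3)]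
        show "{\<omega> \<in> space M. B s \<omega> \<in> {a..?b} \<and> B t \<omega> \<in> {-1..1}} \<in> events"
          by measurable
        show "{\<omega> \<in> space M. sqrt 2 * (W s \<omega> - W 0 \<omega>) \<in> {a..?b} \<and>
            sqrt 2 * (W t \<omega> - W 0 \<omega>) \<in> {-1..1}} \<in> events"
          by measurable
        show "AE \<omega> in M. (\<omega> \<in> {\<omega> \<in> space M. sqrt 2 * (W s \<omega> - W 0 \<omega>) \<in> {a..?b} \<and>
            sqrt 2 * (W t \<omega> - W 0 \<omega>) \<in> {-1..1}}) =
            (\<omega> \<in> {\<omega> \<in> space M. B s \<omega> \<in> {a..?b} \<and> B t \<omega> \<in> {-1..1}})"
          using B_AE by eventually_elim (use \<open>0 \<le> s\<close> t in auto)
      qed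
      finally show "(1 / (8 * a\<^sup>2) * exp (- (?b\<^sup>2 / t)) / sqrt (4 * pi * t))\<^sup>2 \<le>
          prob {\<omega> \<in> space M. B s \<omega> \<in> {a..?b} \<and> B t \<omega> \<in> {-1..1}}"
        by simp
    qed (use that t in \<open>auto simp: xa_def x0_def axis_3_nth\<close>)

    \<comment> \<open>Irregularity of the mean\<close>
    show "\<not> locally_hoelder (\<lambda>x. expectation (X x t))"
    proof (rule not_locally_hoelderI[where x = x0 and e = "axis 3 1" and \<rho> = "loss_bound t"])
      fix a :: real assume "1 \<le> a"
      then have "loss_bound t a \<le> expectation (?loss a)" by (rule loss_ge)
      \<comment> \<open>The loss is nonnegative, so removing the indicator can only increase the
        expectation.\<close>
      also have "\<dots> \<le> expectation (\<lambda>\<omega>. t - drift_integral (xa a) t \<omega>)"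
        using abs_le[of "xa a"] A_int[of "xa a"] loss_int[of a]
        by (intro integral_mono) (auto simp: indicator_def)
      also have "\<dots> = t - expectation (drift_integral (xa a) t)"
        using A_int[of "xa a"] by (simp add: prob_space)
      also have "\<dots> = - ((expectation (X (xa a) t) - expectation (X x0 t)) $ 1)"
        unfolding EX by (simp add: axis_3_nth xa_def drift_x0 prob_space)
      also have "\<dots> \<le> dist (expectation (X (xa a) t)) (expectation (X x0 t))"
        using component_le_norm_cart[of "expectation (X (xa a) t) - expectation (X x0 t)" 1]
        by (simp add: dist_norm)
      finally show "loss_bound t a \<le>
          dist (expectation (X (x0 + exp (- (a ^ 3)) *\<^sub>R axis 3 1) t)) (expectation (X x0 t))"
        by (simp add: xa_def)
    qed (use t loss_bound_filterlim[of t 1] in auto)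

    \<comment> \<open>Irregularity for the test function\<close>
    define c where "c = exp (-1) / R\<^sup>2 * (2 * T)"
    have "0 < c" using \<open>3 \<le> R\<close> assms(3) by (simp add: c_def)
    have \<phi>_ge: "c * ?loss a \<omega> \<le> \<phi> (Z x0 t \<omega>) - \<phi> (Z (xa a) t \<omega>)" if "1 \<le> a" for a \<omega>
    proof -
      define A where "A = drift_integral (xa a) t \<omega>"
      define h where "h = exp (- (a ^ 3))"
      have A: "A \<le> t" "- t \<le> A" using abs_le[of "xa a" \<omega>] by (auto simp: A_def)
      have "h\<^sup>2 \<le> 1\<^sup>2" using that unfolding h_def by (intro power_mono) auto
      let ?r0 = "R - ((- 2 * T + t)\<^sup>2 + (B t \<omega>)\<^sup>2)"
      let ?r1 = "R - ((- 2 * T + A)\<^sup>2 + (B t \<omega>)\<^sup>2 + h\<^sup>2)"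
      have \<phi>: "\<phi> (Z x0 t \<omega>) = flat_exp 1 ?r0" "\<phi> (Z (xa a) t \<omega>) = flat_exp 1 ?r1"
        by (simp_all add: \<phi>_def Z_def inner_vec_3 axis_3_nth drift_x0 x0_nth xa_def A_def h_def)
      \<comment> \<open>The identity behind this is
        \<open>(A - 2T)^2 - (t - 2T)^2 = (4T - A - t) (t - A)\<close>, whose first factor is at
        least \<open>2T\<close> since \<open>A \<le> t \<le> T\<close>; the term \<open>h^2\<close>
        works in the same direction.\<close>
      have "(2 * T) * (t - A) \<le> (4 * T - A - t) * (t - A)"
        using A t by (intro mult_right_mono) auto
      also have "\<dots> \<le> ?r0 - ?r1"
        by (simp add: power2_eq_square algebra_simps)
      finally have r_diff: "(2 * T) * (t - A) \<le> ?r0 - ?r1" .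
      moreover have "0 \<le> (2 * T) * (t - A)" using A assms(3) by simp
      ultimately have r_le: "?r1 \<le> ?r0" by linarith
      show ?thesis
      proof (cases "B t \<omega> \<in> {-1..1}")
        case True
        then have "(B t \<omega>)\<^sup>2 \<le> 1" by (auto simp: abs_square_le_1 abs_le_iff)
        moreover have "(- 2 * T + A)\<^sup>2 \<le> (3 * T)\<^sup>2"
          using A t by (intro abs_le_square_iff[THEN iffD1]) auto
        ultimately have "1 \<le> ?r1"
          using \<open>h\<^sup>2 \<le> 1\<^sup>2\<close> by (simp add: R_def power_mult_distrib)
        moreover have "?r0 \<le> R" by simp
        \<comment> \<open>The increment bound with \<open>Q = R\<close>; combined with the factor
          \<open>2T\<close> in \<open>r_diff\<close> it yields the constant
          \<open>c\<close>.\<close>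
        ultimately have "exp (-1) / R\<^sup>2 * (?r0 - ?r1) \<le> flat_exp 1 ?r0 - flat_exp 1 ?r1"
          using r_le by (intro flat_exp_1_increment)
        moreover have "exp (-1) / R\<^sup>2 * ((2 * T) * (t - A)) \<le> exp (-1) / R\<^sup>2 * (?r0 - ?r1)"
          using r_diff by (intro mult_left_mono) auto
        ultimately show ?thesis
          unfolding \<phi> using True by (simp add: c_def A_def[symmetric] mult.assoc)
      next
        \<comment> \<open>Off the return event the left-hand side is \<open>0\<close>, and
          monotonicity of \<open>flat_exp 1\<close> gives the right sign.\<close>
        case False
        then show ?thesis unfolding \<phi> using flat_exp_1_mono[OF r_le] by simp
      qed
    qed
    have \<phi>_int: "integrable M (\<lambda>\<omega>. \<phi> (Z x t \<omega>))" for x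
      by (rule integrable_const_bound[where B = 1])
         (auto intro!: \<phi>_meas \<phi>_bounded[unfolded real_norm_def] t)
    show "\<not> locally_hoelder (\<lambda>x. expectation (\<lambda>\<omega>. \<phi> (X x t \<omega>)))"
      unfolding E\<phi>
    proof (rule not_locally_hoelderI[where x = x0 and e = "axis 3 1" and \<rho> = "\<lambda>a. c * loss_bound t a"])
      fix a :: real assume a: "1 \<le> a"
      have "c * loss_bound t a \<le> c * expectation (?loss a)"
        using loss_ge[OF a] \<open>0 < c\<close> by simp
      also have "\<dots> = expectation (\<lambda>\<omega>. c * ?loss a \<omega>)" by simp
      also have "\<dots> \<le> expectation (\<lambda>\<omega>. \<phi> (Z x0 t \<omega>) - \<phi> (Z (xa a) t \<omega>))"
        by (intro integral_mono \<phi>_ge[OF a] integrable_mult_right loss_int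
              Bochner_Integration.integrable_diff \<phi>_int)
      also have "\<dots> = expectation (\<lambda>\<omega>. \<phi> (Z x0 t \<omega>)) - expectation (\<lambda>\<omega>. \<phi> (Z (xa a) t \<omega>))"
        by (intro Bochner_Integration.integral_diff \<phi>_int)
      also have "\<dots> \<le> dist (expectation (\<lambda>\<omega>. \<phi> (Z (xa a) t \<omega>))) (expectation (\<lambda>\<omega>. \<phi> (Z x0 t \<omega>)))"
        by (simp add: dist_real_def)
      finally show "c * loss_bound t a \<le>
          dist (expectation (\<lambda>\<omega>. \<phi> (Z (x0 + exp (- (a ^ 3)) *\<^sub>R axis 3 1) t \<omega>)))
            (expectation (\<lambda>\<omega>. \<phi> (Z x0 t \<omega>)))"
        by (simp add: xa_def)
    qed (use t \<open>0 < c\<close> in \<open>auto intro!: loss_bound_filterlim\<close>)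
  qed
qed

end
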